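(* Let $p$ be an odd prime, $\zeta = e^{2\pi\sqrt{-1}/p}$, $i = \sqrt{-1}$, $p^{\ast} = (-1)^{\frac{p-1}{2}}p$, and let $f, g \in \mathbb{Z}[x]$ be the polynomials defined (after fixing a square root $\sqrt{p^{\ast}}$ of $p^{\ast}$ in $\mathbb{C}$) by $$2\prod_{\substack{1\le k<p\\ \left(\frac{k}{p}\right)=1}}(x-\zeta^k) = f(x)+\sqrt{p^{\ast}}\,g(x), \qquad 2\prod_{\substack{1\le k<p\\ \left(\frac{k}{p}\right)=-1}}(x-\zeta^k) = f(x)-\sqrt{p^{\ast}}\,g(x).$$ Define $(a,b)$ as follows. (1) If $p \equiv 1 \pmod 8$: $$(a,b)=\left(\frac14\left(g(1)^2+\frac{f(1)^2}{p}\right),\ \frac{f(1)g(1)}{2p}\right).$$ (2) If $p \equiv 5 \pmod 8$: $$a=\frac{1}{64}\left(\left(g(1)^3+\frac{3f(1)^2g(1)}{p}\right)^2+p\left(\frac{f(1)^3}{p^2}+\frac{3g(1)^2f(1)}{p}\right)^2\right),$$ $$b=\frac{1}{32}\left(g(1)^3+\frac{3f(1)^2g(1)}{p}\right)\left(\frac{f(1)^3}{p^2}+\frac{3g(1)^2f(1)}{p}\right).$$ (3) If $p \equiv 3 \pmod 4$: $$(a,b)=\left(\frac{i^{\ast}}{4}\left(p\,g(i)^2-f(i)^2\right),\ \frac12 g(i)f(i)\right),$$ where $i^{\ast}=-i$ if $p\equiv 3 \pmod 8$ and $i^{\ast}=i$ if $p\equiv 7 \pmod 8$. Then in each case $a,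 b \in \mathbb{Z}$ and $a^2 - p b^2 = 1$, i.e. $(a,b)$ is an integral solution of Pell's equation $x^2-py^2=1$.
   Context: $\left(\frac{k}{p}\right)$ denotes the Legendre symbol. The polynomials $f$ and $g$ are determined by the two displayed identities; they have integer coefficients.
   Formalization: The claim that a and b are integers is made only for p ≠ 3, since for p = 3 one gets a = -1 - (3/2)i, which is not an integer; the equation a^2 - p b^2 = 1 is still claimed for every odd prime p. *)

theory Defs
  imports Complex_Main "HOL-Number_Theory.Number_Theory"
    "HOL-Computational_Algebra.Polynomial"
begin

definition zeta :: "nat \<Rightarrow> complex" where
  "zeta p = exp (2 * of_real pi * \<i> / of_nat p)"

definition pstar :: "nat \<Rightarrow> int" where
  "pstar p = (-1) ^ ((p - 1) div 2) * int p"

definition legendre_prod :: "nat \<Rightarrow> int \<Rightarrow> complex poly" where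
  "legendre_prod p e =
     (\<Prod>k\<in>{k. 1 \<le> k \<and> k < p \<and> Legendre (int k) (int p) = e}. [:- (zeta p ^ k), 1:])"

definition cpoly :: "int poly \<Rightarrow> complex poly" where
  "cpoly h = map_poly of_int h"

(* Meant for p congruent to 3 mod 4 only, so "else" is the case p congruent to 7 mod 8.
   For p = 3 the product of the zeta p ^ k over the residues k is not 1, and the values
   a, b built from f(i), g(i) satisfy the Pell equation but are not integers. *)
definition istar :: "nat \<Rightarrow> complex" where
  "istar p = (if [p = 3] (mod 8) then - \<i> else \<i>)"

end

theory Submission
  imports Defs
begin

text \<open>Write \<open>R\<close> and \<open>N\<close> for the products over the residues and the nonresidues. Then \<open>f = R + N\<close>,
  \<open>s g = R - N\<close> and \<open>R N = 1 + x + \<dots> + x ^ (p - 1)\<close>, hence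
  \<open>f\<^sup>2 - s\<^sup>2 g\<^sup>2 = 4 (1 + x + \<dots> + x ^ (p - 1))\<close>.
  For \<open>p\<close> congruent to 1 modulo 4, taking \<open>x = 1\<close> gives \<open>p F\<^sup>2 - g(1)\<^sup>2 = 4\<close> with \<open>f(1) = p F\<close>;
  for \<open>p\<close> congruent to 3 modulo 4, taking \<open>x = \<i>\<close> gives \<open>f(\<i>)\<^sup>2 + p g(\<i>)\<^sup>2 = 4 \<i>\<close>; each Pell equation is an
  algebraic consequence. Integrality at \<open>\<i>\<close> comes from the reciprocity
  \<open>x ^ ((p - 1) / 2) R(1/x) = - N(x)\<close>, valid for \<open>p > 3\<close>, which forces the Gaussian integers
  \<open>f(\<i>)\<close> and \<open>g(\<i>)\<close> to be rational integer multiples of \<open>1 \<plusminus> \<i>\<close>.\<close>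

subsection \<open>The Legendre symbol\<close>

text \<open>The index set of \<open>legendre_prod p e\<close>, named so that products over it can be
  reindexed by permutations.\<close>

definition legendre_class :: "nat \<Rightarrow> int \<Rightarrow> nat set" where
  "legendre_class p e = {k. 1 \<le> k \<and> k < p \<and> Legendre (int k) (int p) = e}"

lemma finite_legendre_class [simp]: "finite (legendre_class p e)"
  by (rule finite_subset[of _ "{..<p}"]) (auto simp: legendre_class_def)

lemma Legendre_cong:
  assumes "[a = b] (mod p)"
  shows "Legendre a p = Legendre b p"
proof -
  have "[a = 0] (mod p) \<longleftrightarrow> [b = 0] (mod p)"
    using assms cong_sym cong_trans by blast
  moreover have "QuadRes p a \<longleftrightarrow> QuadRes p b"
    unfolding QuadRes_def using assms cong_sym cong_trans by blast
  ultimately show ?thesis by (simp add: Legendre_def)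
qed

lemma Legendre_cases: "Legendre a p \<in> {-1, 0, 1}"
  by (simp add: Legendre_def)

text \<open>Two signs differ by at most 2, so a modulus above 2 cannot divide a nonzero difference.
  This turns the congruences of Euler's criterion into equations between Legendre symbols.\<close>

lemma sign_cong_imp_eq:
  fixes x y q :: int
  assumes "[x = y] (mod q)" "2 < q" "x \<in> {-1, 0, 1}" "y \<in> {-1, 0, 1}"
  shows "x = y"
proof -
  have "q dvd x - y" using assms(1) by (simp add: cong_iff_dvd_diff)
  moreover have "\<bar>x - y\<bar> < q" using assms(2-4) by auto
  ultimately show ?thesis using dvd_imp_le_int[of "x - y" q] assms(2) by fastforce
qed

lemma Legendre_mult:
  fixes p :: nat
  assumes "prime p" "2 < p"
  shows "Legendre (a * b) p = Legendre a p * Legendre b p"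
proof (rule sign_cong_imp_eq)
  have "[Legendre (a * b) p = (a * b) ^ ((p - 1) div 2)] (mod p)"
    by (rule euler_criterion[OF assms])
  also have "(a * b) ^ ((p - 1) div 2) = a ^ ((p - 1) div 2) * b ^ ((p - 1) div 2)"
    by (simp add: power_mult_distrib)
  also have "[a ^ ((p - 1) div 2) * b ^ ((p - 1) div 2) = Legendre a p * Legendre b p] (mod p)"
    using euler_criterion[OF assms, of a] euler_criterion[OF assms, of b]
    by (intro cong_mult) (simp_all add: cong_sym)
  finally show "[Legendre (a * b) p = Legendre a p * Legendre b p] (mod p)" .
  show "Legendre a p * Legendre b p \<in> {-1, 0, 1}"
    using Legendre_cases[of a p] Legendre_cases[of b p] by auto
qed (use assms Legendre_cases in auto)

lemma Legendre_minus_one: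
  fixes p :: nat
  assumes "prime p" "[p = 3] (mod 4)"
  shows "Legendre (-1) p = -1"
proof (rule sign_cong_imp_eq)
  have p: "p mod 4 = 3" using assms(2) by (simp add: cong_def)
  then have "2 < p" by presburger
  then show "2 < int p" by simp
  have "odd ((p - 1) div 2)" using p by presburger
  then show "[Legendre (-1) p = -1] (mod p)"
    using euler_criterion[OF assms(1) \<open>2 < p\<close>, of "-1"] by simp
qed (use Legendre_cases in auto)

lemma Legendre_four:
  fixes p :: nat
  assumes "prime p" "2 < p"
  shows "Legendre 4 p = 1"
proof -
  have "\<not> int p dvd 4"
  proof
    assume "int p dvd 4"
    then have "p dvd 2 ^ 2" using int_dvd_int_iff[of p 4] by simp
    then have "p dvd 2" using assms(1) prime_dvd_power by blast
    then show False using assms(2) by (auto dest: dvd_imp_le)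
  qed
  moreover have "QuadRes (int p) 4"
    unfolding QuadRes_def by (rule exI[of _ 2]) simp
  ultimately show ?thesis by (simp add: Legendre_def cong_0_iff)
qed

section \<open>The classes of residues and nonresidues, and bijections between them\<close>

lemma legendre_class_Un:
  assumes "prime p"
  shows "legendre_class p 1 \<union> legendre_class p (-1) = {1..<p}"
    and "legendre_class p 1 \<inter> legendre_class p (-1) = {}"
proof -
  have "\<not> int p dvd int k" if "1 \<le> k" "k < p" for k
    using that by (auto dest: dvd_imp_le)
  then have "Legendre (int k) (int p) \<noteq> 0" if "1 \<le> k" "k < p" for k
    using that by (auto simp: Legendre_def cong_0_iff)
  then show "legendre_class p 1 \<union> legendre_class p (-1) = {1..<p}"
    using Legendre_cases by (fastforce simp: legendre_class_def)
qed (auto simp: legendre_class_def)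

text \<open>The factor 4 is a square prime to \<open>p\<close>, so it preserves the Legendre symbol;
  an injective self-map of a finite set is onto.\<close>

lemma bij_betw_legendre_class_times_4:
  assumes "prime p" "2 < p"
  shows "bij_betw (\<lambda>k. (4 * k) mod p) (legendre_class p e) (legendre_class p e)"
proof -
  have cop: "coprime 4 p"
  proof -
    have "coprime 2 p" using assms by (simp add: prime_odd_nat)
    then have "coprime (2 ^ 2) p" by (simp only: coprime_power_left_iff) simp
    then show ?thesis by simp
  qed
  have inj: "inj_on (\<lambda>k. (4 * k) mod p) (legendre_class p e)"
  proof (rule inj_onI)
    fix j k assume jk: "j \<in> legendre_class p e" "k \<in> legendre_class p e"
      and "4 * j mod p = 4 * k mod p"
    then have "[j = k] (mod p)" using cop cong_mult_lcancel_nat by (auto simp: cong_def)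
    then show "j = k" using jk by (simp add: legendre_class_def cong_def)
  qed
  have "(4 * k) mod p \<in> legendre_class p e" if k: "k \<in> legendre_class p e" for k
  proof -
    have "\<not> p dvd k" using k by (auto simp: legendre_class_def dest: dvd_imp_le)
    then have "\<not> p dvd 4 * k" using cop coprime_commute coprime_dvd_mult_right_iff by blast
    then have "(4 * k) mod p > 0" by (simp add: dvd_eq_mod_eq_0)
    moreover have "Legendre (int ((4 * k) mod p)) p = Legendre (4 * int k) p"
      by (rule Legendre_cong) (simp add: cong_def of_nat_mod)
    ultimately show ?thesis
      using k assms by (simp add: legendre_class_def Legendre_mult Legendre_four)
  qed
  then have "(\<lambda>k. (4 * k) mod p) ` legendre_class p e \<subseteq> legendre_class p e" by auto
  then show ?thesis
    using inj endo_inj_surj[OF finite_legendre_class] by (simp add: bij_betw_def)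
qed

text \<open>Modulo \<open>p\<close> the map is negation, and -1 is a nonresidue here, so this
  involution flips the symbol.\<close>

lemma bij_betw_legendre_class_reflect:
  assumes "prime p" "[p = 3] (mod 4)"
  shows "bij_betw (\<lambda>k. p - k) (legendre_class p e) (legendre_class p (-e))"
proof (rule bij_betwI[where g = "\<lambda>k. p - k"])
  have "p mod 4 = 3" using assms(2) by (simp add: cong_def)
  then have "2 < p" by presburger
  have *: "p - k \<in> legendre_class p (-e)" if k: "k \<in> legendre_class p e" for k e
  proof -
    have "Legendre (int (p - k)) p = Legendre (-1 * int k) p"
      using k by (intro Legendre_cong) (auto simp: legendre_class_def of_nat_diff cong_iff_dvd_diff)
    also have "\<dots> = Legendre (-1) p * Legendre (int k) p"
      by (rule Legendre_mult[OF assms(1) \<open>2 < p\<close>])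
    finally show ?thesis
      using k by (auto simp: legendre_class_def Legendre_minus_one[OF assms])
  qed
  show "(\<lambda>k. p - k) \<in> legendre_class p e \<rightarrow> legendre_class p (-e)" using * by auto
  show "(\<lambda>k. p - k) \<in> legendre_class p (-e) \<rightarrow> legendre_class p e" using *[of _ "-e"] by auto
qed (auto simp: legendre_class_def)

subsection \<open>Products over roots of unity\<close>

lemma zeta_power_self: "p > 0 \<Longrightarrow> zeta p ^ p = 1"
  by (simp add: zeta_def flip: exp_of_nat_mult)

lemma zeta_power_mod: "p > 0 \<Longrightarrow> zeta p ^ (k mod p) = zeta p ^ k"
proof -
  assume "p > 0"
  have "zeta p ^ k = zeta p ^ (p * (k div p) + k mod p)" by simp
  also have "\<dots> = zeta p ^ (k mod p)"
    by (simp only: power_add power_mult zeta_power_self[OF \<open>p > 0\<close>]) simp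
  finally show ?thesis ..
qed

lemma zeta_nonzero [simp]: "zeta p \<noteq> 0"
  by (simp add: zeta_def)

lemma inj_on_zeta_power:
  assumes "p > 0"
  shows "inj_on (\<lambda>k. zeta p ^ k) {..<p}"
proof -
  have "zeta p ^ k = cis (2 * pi * real k / real p)" for k
    by (simp add: zeta_def cis_conv_exp flip: exp_of_nat_mult) (simp add: mult_ac)
  then show ?thesis using bij_betw_roots_unity[OF assms] by (simp add: bij_betw_def)
qed

lemma degree_prod_linear: "finite A \<Longrightarrow> degree (\<Prod>k\<in>A. [:- c k, 1 :: complex:]) = card A"
  by (simp add: degree_prod_eq_sum_degree)

text \<open>Both sides are monic of degree \<open>p - 1\<close> in \<open>x\<close> and vanish at
  the \<open>p - 1\<close> distinct powers of \<open>zeta p\<close> other than 1.\<close>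

lemma prod_minus_zeta_power:
  assumes "p > 0"
  shows "(\<Prod>k\<in>{1..<p}. x - zeta p ^ k) = (\<Sum>j<p. x ^ j)"
proof -
  define P where "P = (\<Prod>k\<in>{1..<p}. [:- (zeta p ^ k), 1:])"
  define Q where "Q = (\<Sum>j<p. monom (1::complex) j)"
  have degP: "degree P = p - 1" by (simp add: P_def degree_prod_linear)
  have "lead_coeff P = 1" by (simp add: P_def lead_coeff_prod)
  then have coeffP: "coeff P (p - 1) = 1" using degP by simp
  have coeffQ: "coeff Q (p - 1) = 1" using assms by (simp add: Q_def coeff_sum)
  have degQ: "degree Q \<le> p - 1"
    unfolding Q_def by (rule degree_sum_le) (auto intro: order_trans[OF degree_monom_le])
  have "P = Q"
  \<comment> \<open>Since the coefficients at \<open>p - 1\<close> agree, \<open>p - 1\<close>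
    common values suffice, one fewer than the degree alone would require.\<close>
  proof (rule poly_eqI_degree_lead_coeff)
    show "coeff P (p - 1) = coeff Q (p - 1)" using coeffP coeffQ by (rule trans[OF _ sym])
    have "inj_on (\<lambda>k. zeta p ^ k) {1..<p}"
      by (rule inj_on_subset[OF inj_on_zeta_power[OF assms]]) auto
    then show "p - 1 \<le> card ((\<lambda>k. zeta p ^ k) ` {1..<p})" by (simp add: card_image)
    fix z assume "z \<in> (\<lambda>k. zeta p ^ k) ` {1..<p}"
    then obtain k where k: "k \<in> {1..<p}" "z = zeta p ^ k" by auto
    have "poly P z = 0" using k by (auto simp: P_def poly_prod)
    have "z ^ p = 1"
      using zeta_power_self[OF assms] by (metis k(2) power_commutes power_mult power_one mult.commute)
    moreover have "z \<noteq> 1"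
      using inj_onD[OF inj_on_zeta_power[OF assms], of k 0] k by auto
    ultimately have "poly Q z = 0"
      by (simp add: Q_def poly_sum poly_monom geometric_sum)
    then show "poly P z = poly Q z" using \<open>poly P z = 0\<close> by simp
  qed (use degP degQ in auto)
  then have "poly P x = poly Q x" by simp
  then show ?thesis by (simp add: P_def Q_def poly_prod poly_sum poly_monom)
qed

section \<open>The products over the two classes\<close>

lemma poly_legendre_prod:
  "poly (legendre_prod p e) x = (\<Prod>k\<in>legendre_class p e. x - zeta p ^ k)"
  by (simp add: legendre_prod_def legendre_class_def poly_prod)

lemma legendre_prod_mult:
  assumes "prime p"
  shows "poly (legendre_prod p 1) x * poly (legendre_prod p (-1)) x = (\<Sum>j<p. x ^ j)"
  using prod.union_disjoint[of "legendre_class p 1" "legendre_class p (-1)" "\<lambda>k. x - zeta p ^ k"]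
    legendre_class_Un[OF assms] prod_minus_zeta_power[OF prime_gt_0_nat[OF assms]]
  by (simp add: poly_legendre_prod)

text \<open>Multiplication by 4 permutes the class, so the product \<open>P\<close> satisfies \<open>P = P ^ 4\<close>; together
  with \<open>P ^ p = 1\<close> this leaves only \<open>P = 1\<close>.\<close>

lemma prod_zeta_legendre_class:
  assumes "prime p" "3 < p"
  shows "(\<Prod>k\<in>legendre_class p e. zeta p ^ k) = 1"
proof -
  define P where "P = (\<Prod>k\<in>legendre_class p e. zeta p ^ k)"
  have "p > 0" using assms by simp
  have "P = (\<Prod>k\<in>legendre_class p e. zeta p ^ ((4 * k) mod p))"
    unfolding P_def using assms
    by (subst prod.reindex_bij_betw[OF bij_betw_legendre_class_times_4[of p e]]) auto
  also have "\<dots> = (\<Prod>k\<in>legendre_class p e. (zeta p ^ k) ^ 4)"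
    by (simp only: zeta_power_mod[OF \<open>p > 0\<close>] power_mult mult.commute[of 4])
  also have "\<dots> = P ^ 4" by (simp only: P_def prod_power_distrib)
  finally have "P * P ^ 3 = P * 1" by (simp add: eval_nat_numeral)
  moreover have "P \<noteq> 0" by (simp add: P_def)
  ultimately have P3: "P ^ 3 = 1" by (simp only: mult_cancel_left) simp
  have "P ^ p = (\<Prod>k\<in>legendre_class p e. (zeta p ^ p) ^ k)"
    by (simp add: P_def prod_power_distrib mult.commute flip: power_mult)
  then have Pp: "P ^ p = 1" using zeta_power_self[OF \<open>p > 0\<close>] by simp
  have "P ^ p = (P ^ 3) ^ (p div 3) * P ^ (p mod 3)"
    by (simp flip: power_mult power_add)
  then have Pm: "P ^ (p mod 3) = 1" using P3 Pp by simp
  \<comment> \<open>Here \<open>p = 3\<close> drops out: its residue class is {1}, with product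
    \<open>zeta 3\<close>, a primitive cube root of unity.\<close>
  have "\<not> 3 dvd p" using assms by (metis less_irrefl prime_nat_iff numeral_eq_one_iff semiring_norm(86))
  then have "p mod 3 = 1 \<or> p mod 3 = 2" by presburger
  then have "P = 1"
  proof
    assume "p mod 3 = 2"
    then have "P ^ 2 = 1" using Pm by simp
    then show ?thesis using P3 by (simp add: power3_eq_cube power2_eq_square)
  qed (use Pm in simp)
  then show ?thesis by (simp add: P_def)
qed

lemma card_legendre_class:
  assumes "prime p" "[p = 3] (mod 4)" "e \<in> {1, -1}"
  shows "card (legendre_class p e) = (p - 1) div 2"
proof -
  have "card (legendre_class p 1) = card (legendre_class p (-1))"
    using bij_betw_same_card[OF bij_betw_legendre_class_reflect[OF assms(1,2), of 1]] .
  moreover have "card (legendre_class p 1) + card (legendre_class p (-1)) = p - 1"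
    using card_Un_disjoint[of "legendre_class p 1" "legendre_class p (-1)"]
      legendre_class_Un[OF assms(1)] by simp
  ultimately show ?thesis using assms(3) by auto
qed

text \<open>With \<open>z = zeta p ^ k\<close>, each factor obeys
  \<open>x * (y - z) = 1 - x * z = - z * (x - 1/z)\<close>, where
  \<open>1/z = zeta p ^ (p - k)\<close>. The factors \<open>z\<close> multiply to 1, reflection
  passes to the opposite class, and the odd number \<open>(p - 1) div 2\<close> of signs leaves
  -1.\<close>

lemma legendre_prod_reciprocal:
  assumes "prime p" "[p = 3] (mod 4)" "3 < p" "e \<in> {1, -1}"
  assumes "x * y = 1"
  shows "x ^ ((p - 1) div 2) * poly (legendre_prod p e) y = - poly (legendre_prod p (-e)) x"
proof -
  let ?C = "legendre_class p e"
  have p: "p mod 4 = 3" using assms(2) by (simp add: cong_def)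
  have zz: "zeta p ^ k * zeta p ^ (p - k) = 1" if "k \<in> ?C" for k
    using that zeta_power_self[of p] by (simp add: legendre_class_def flip: power_add)
  have "x ^ ((p - 1) div 2) * poly (legendre_prod p e) y = (\<Prod>k\<in>?C. x * (y - zeta p ^ k))"
    using card_legendre_class[OF assms(1,2,4)]
    by (simp only: poly_legendre_prod prod.distrib prod_constant)
  also have "\<dots> = (\<Prod>k\<in>?C. (-1) * zeta p ^ k * (x - zeta p ^ (p - k)))"
  proof (rule prod.cong[OF refl])
    fix k assume "k \<in> ?C"
    show "x * (y - zeta p ^ k) = (-1) * zeta p ^ k * (x - zeta p ^ (p - k))"
      using zz[OF \<open>k \<in> ?C\<close>] assms(5) by (simp add: algebra_simps)
  qed
  also have "\<dots> = (-1) ^ ((p - 1) div 2) * (\<Prod>k\<in>?C. zeta p ^ k) * (\<Prod>k\<in>?C. x - zeta p ^ (p - k))"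
    using card_legendre_class[OF assms(1,2,4)] by (simp only: prod.distrib prod_constant)
  also have "(\<Prod>k\<in>?C. x - zeta p ^ (p - k)) = poly (legendre_prod p (-e)) x"
    unfolding poly_legendre_prod
    by (rule prod.reindex_bij_betw[OF bij_betw_legendre_class_reflect[OF assms(1,2)]])
  also have "(\<Prod>k\<in>?C. zeta p ^ k) = 1"
    by (rule prod_zeta_legendre_class[OF assms(1,3)])
  also have "(-1 :: complex) ^ ((p - 1) div 2) = -1"
  proof -
    have "odd ((p - 1) div 2)" using p by presburger
    then show ?thesis by simp
  qed
  finally show ?thesis by simp
qed

subsection \<open>Values of integer polynomials\<close>

lemma cpoly_at_1: "poly (cpoly h) 1 = of_int (poly h 1)"
  by (induction h) (simp_all add: cpoly_def map_poly_pCons)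

text \<open>Integer coefficients make the two values conjugate Gaussian integers. Sharing
  \<open>u\<close> and \<open>v\<close> lets a relation between the values at \<open>\<i>\<close>
  and \<open>- \<i>\<close> become a condition on a single pair.\<close>

lemma cpoly_at_ii:
  "\<exists>u v. poly (cpoly h) \<i> = of_int u + \<i> * of_int v \<and> poly (cpoly h) (- \<i>) = of_int u - \<i> * of_int v"
proof (induction h)
  case 0
  then show ?case by (auto simp: cpoly_def intro!: exI[of _ 0])
next
  case (pCons c h)
  then obtain u v where "poly (cpoly h) \<i> = of_int u + \<i> * of_int v"
    "poly (cpoly h) (- \<i>) = of_int u - \<i> * of_int v" by blast
  then show ?case
    \<comment> \<open>Horner's rule:
      \<open>c + \<i> * (u + \<i> * v) = (c - v) + \<i> * u\<close>.\<close>
    by (intro exI[of _ "c - v"] exI[of _ u])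
      (simp add: cpoly_def map_poly_pCons ring_distribs flip: mult.assoc)
qed

subsection \<open>The Pell equation\<close>

text \<open>Stated with \<open>s ^ 2\<close>, so that one identity serves both signs of
  \<open>pstar p\<close>.\<close>

lemma norm_form:
  fixes s :: complex and f g :: "int poly"
  assumes "prime p"
    and "smult 2 (legendre_prod p 1) = cpoly f + smult s (cpoly g)"
    and "smult 2 (legendre_prod p (-1)) = cpoly f - smult s (cpoly g)"
  shows "poly (cpoly f) x ^ 2 - s ^ 2 * poly (cpoly g) x ^ 2 = 4 * (\<Sum>j<p. x ^ j)"
proof -
  have "2 * poly (legendre_prod p 1) x = poly (cpoly f) x + s * poly (cpoly g) x"
    using arg_cong[OF assms(2), of "\<lambda>q. poly q x"] by simp
  moreover have "2 * poly (legendre_prod p (-1)) x = poly (cpoly f) x - s * poly (cpoly g) x"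
    using arg_cong[OF assms(3), of "\<lambda>q. poly q x"] by simp
  ultimately have "(2 * poly (legendre_prod p 1) x) * (2 * poly (legendre_prod p (-1)) x)
      = poly (cpoly f) x ^ 2 - s ^ 2 * poly (cpoly g) x ^ 2"
    by (simp only:) (simp add: algebra_simps power2_eq_square)
  then show ?thesis using legendre_prod_mult[OF assms(1), of x] by simp
qed

section \<open>Primes congruent to 1 modulo 4: values at 1 and elements of norm -1\<close>

text \<open>At 1 the geometric sum is \<open>p\<close>, so \<open>p\<close> divides the square of
  \<open>poly f 1\<close>, hence \<open>poly f 1\<close> itself. The quotient \<open>F\<close>
  clears the denominators in the formulas for \<open>a\<close> and \<open>b\<close>.\<close>

lemma norm_form_at_1:
  fixes s :: complex and f g :: "int poly"
  assumes "prime p" "s ^ 2 = of_nat p"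
    and "smult 2 (legendre_prod p 1) = cpoly f + smult s (cpoly g)"
    and "smult 2 (legendre_prod p (-1)) = cpoly f - smult s (cpoly g)"
  obtains F where "poly f 1 = int p * F" "int p * F ^ 2 = (poly g 1) ^ 2 + 4"
proof -
  have "complex_of_int (poly f 1 ^ 2 - int p * poly g 1 ^ 2) = of_int (4 * int p)"
    using norm_form[OF assms(1,3,4), of 1] assms(2) by (simp add: cpoly_at_1)
  then have eq: "poly f 1 ^ 2 - int p * poly g 1 ^ 2 = 4 * int p"
    using of_int_eq_iff by blast
  then have "poly f 1 ^ 2 = int p * (poly g 1 ^ 2 + 4)" by (simp add: algebra_simps)
  then have "int p dvd poly f 1 ^ 2" by simp
  then have "int p dvd poly f 1" using assms(1) by (meson prime_dvd_power prime_nat_int_transfer)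
  then obtain F where F: "poly f 1 = int p * F" by blast
  then have "int p * (int p * F ^ 2) = int p * (poly g 1 ^ 2 + 4)"
    using eq by (simp add: algebra_simps power2_eq_square)
  then have "int p * F ^ 2 = poly g 1 ^ 2 + 4" using assms(1) by auto
  then show ?thesis using F that by blast
qed

lemma norm_form_parity:
  fixes p F G :: int
  assumes "p * F ^ 2 = G ^ 2 + 4" "odd p"
  shows "even F \<longleftrightarrow> even G"
proof -
  have "even (p * F ^ 2) \<longleftrightarrow> even (G ^ 2 + 4)" using assms(1) by simp
  then show ?thesis using assms(2) by simp
qed

lemma odd_square_mod_8:
  fixes x :: int
  assumes "odd x"
  shows "x ^ 2 mod 8 = 1"
proof -
  obtain k where "x = 2 * k + 1" using assms by (rule oddE)
  then have "x ^ 2 = 4 * (k * (k + 1)) + 1" by (simp add: power2_eq_square algebra_simps)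
  moreover obtain m where "k * (k + 1) = 2 * m" by (rule evenE[of "k * (k + 1)"]) simp
  ultimately have "x ^ 2 = 8 * m + 1" by simp
  then show ?thesis by simp
qed

text \<open>The element (G + F sqrt p)/2 has norm -1, so its square, with coordinates
  \<open>x\<close> and \<open>y\<close>, has norm 1. The condition modulo 8 makes \<open>F\<close>
  and \<open>G\<close> even, which gives integrality.\<close>

lemma pell_case1:
  fixes p F G :: int
  assumes "p * F ^ 2 = G ^ 2 + 4" "p mod 8 = 1"
  obtains x y where "G ^ 2 + p * F ^ 2 = 4 * x" "F * G = 2 * y" "x ^ 2 - p * y ^ 2 = 1"
proof -
  have "odd p" using assms(2) by presburger
  have "even F"
  proof (rule ccontr)
    assume "odd F"
    then have "odd G" using norm_form_parity[OF assms(1) \<open>odd p\<close>] by simp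
    \<comment> \<open>With \<open>F\<close> and \<open>G\<close> odd, the left side of the norm
      equation is 1 modulo 8 and the right side is 5.\<close>
    have "(p * F ^ 2) mod 8 = ((p mod 8) * (F ^ 2 mod 8)) mod 8" by (simp add: mod_mult_eq)
    then have "(p * F ^ 2) mod 8 = 1" using odd_square_mod_8[OF \<open>odd F\<close>] assms(2) by simp
    moreover have "G ^ 2 mod 8 = 1" using odd_square_mod_8[OF \<open>odd G\<close>] .
    ultimately show False using assms(1) by presburger
  qed
  moreover have "even G" using norm_form_parity[OF assms(1) \<open>odd p\<close>] calculation by simp
  ultimately obtain m n where mn: "F = 2 * m" "G = 2 * n" by blast
  have eq: "p * m ^ 2 = n ^ 2 + 1" using assms(1) by (simp add: mn power_mult_distrib)
  show ?thesis
  proof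
    \<comment> \<open>The witness is \<open>n ^ 2 + p * m ^ 2\<close>, rewritten by
      \<open>p * m ^ 2 = n ^ 2 + 1\<close>.\<close>
    show "G ^ 2 + p * F ^ 2 = 4 * (2 * n ^ 2 + 1)"
      using assms(1) by (simp add: mn power_mult_distrib)
    show "F * G = 2 * (2 * (m * n))" by (simp add: mn)
    have "(2 * n ^ 2 + 1) ^ 2 - p * (2 * (m * n)) ^ 2 = (2 * n ^ 2 + 1) ^ 2 - 4 * n ^ 2 * (p * m ^ 2)"
      by (simp add: power_mult_distrib)
    also have "\<dots> = 1" unfolding eq by (simp add: power2_eq_square algebra_simps)
    finally show "(2 * n ^ 2 + 1) ^ 2 - p * (2 * (m * n)) ^ 2 = 1" .
  qed
qed

text \<open>The pair \<open>(A, B)\<close> below is the cube of \<open>(G + F \<surd>p) / 2\<close>, an element of norm \<open>-1\<close>.\<close>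

lemma pell_case2:
  fixes p F G :: int
  assumes eq: "p * F ^ 2 = G ^ 2 + 4" and "odd p"
  obtains A B where "G ^ 3 + 3 * p * F ^ 2 * G = 8 * A" "p * F ^ 3 + 3 * G ^ 2 * F = 8 * B"
    "A ^ 2 - p * B ^ 2 = -1"
proof -
  have par: "even F \<longleftrightarrow> even G" by (rule norm_form_parity[OF assms])
  have "G ^ 3 + 3 * p * F ^ 2 * G = G * (G ^ 2 + 3 * (p * F ^ 2))"
    by (simp add: algebra_simps power2_eq_square power3_eq_cube)
  also have "\<dots> = 4 * (G * (G ^ 2 + 3))" unfolding eq by (simp add: algebra_simps)
  finally have 1: "G ^ 3 + 3 * p * F ^ 2 * G = 4 * (G * (G ^ 2 + 3))" .
  have "p * F ^ 3 + 3 * G ^ 2 * F = F * (p * F ^ 2 + 3 * G ^ 2)"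
    by (simp add: algebra_simps power2_eq_square power3_eq_cube)
  also have "\<dots> = 4 * (F * (G ^ 2 + 1))" unfolding eq by (simp add: algebra_simps)
  finally have 2: "p * F ^ 3 + 3 * G ^ 2 * F = 4 * (F * (G ^ 2 + 1))" .
  \<comment> \<open>When \<open>F\<close> and \<open>G\<close> are odd, as for \<open>p = 5\<close>,
    the second factors are even. The cube is thus integral where the element itself is not.\<close>
  have "even (G * (G ^ 2 + 3))" "even (F * (G ^ 2 + 1))" using par by auto
  then obtain A B where AB: "G * (G ^ 2 + 3) = 2 * A" "F * (G ^ 2 + 1) = 2 * B" by blast
  have "4 * (A ^ 2 - p * B ^ 2) = (2 * A) ^ 2 - p * (2 * B) ^ 2" by (simp add: power_mult_distrib)
  also have "\<dots> = G ^ 2 * (G ^ 2 + 3) ^ 2 - (p * F ^ 2) * (G ^ 2 + 1) ^ 2"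
    unfolding AB[symmetric] by (simp add: power_mult_distrib)
  also have "\<dots> = -4" unfolding eq by (simp add: algebra_simps power2_eq_square)
  finally have "A ^ 2 - p * B ^ 2 = -1" by simp
  then show ?thesis using that[of A B] 1 2 AB by simp
qed

section \<open>Primes congruent to 3 modulo 4: values at the imaginary unit\<close>

lemma norm_form_at_ii:
  fixes s :: complex and f g :: "int poly"
  assumes "prime p" "[p = 3] (mod 4)" "s ^ 2 = - of_nat p"
    and "smult 2 (legendre_prod p 1) = cpoly f + smult s (cpoly g)"
    and "smult 2 (legendre_prod p (-1)) = cpoly f - smult s (cpoly g)"
  shows "poly (cpoly f) \<i> ^ 2 + of_nat p * poly (cpoly g) \<i> ^ 2 = 4 * \<i>"
proof -
  have "p mod 4 = 3" using assms(2) by (simp add: cong_def)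
  then have "\<i> ^ p = (\<i> ^ 4) ^ (p div 4) * \<i> ^ 3"
    by (metis mult_div_mod_eq power_add power_mult)
  then have "\<i> ^ p = - \<i>" by (simp add: power3_eq_cube)
  then have "(\<Sum>j<p. \<i> ^ j) = (- \<i> - 1) / (\<i> - 1)" by (simp add: geometric_sum)
  also have "\<dots> = \<i>"
  proof -
    have "\<i> - 1 \<noteq> 0" by (simp add: complex_eq_iff)
    moreover have "- \<i> - 1 = \<i> * (\<i> - 1)" by (simp add: right_diff_distrib)
    ultimately show ?thesis by (simp only: nonzero_mult_div_cancel_right not_False_eq_True)
  qed
  finally show ?thesis using norm_form[OF assms(1,4,5), of \<i>] assms(3) by simp
qed

text \<open>Reciprocity at \<open>x = \<i>\<close>, \<open>y = - \<i>\<close> exchanges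
  \<open>R\<close> and \<open>N\<close> up to sign; their sum gives \<open>f\<close> and their
  difference gives \<open>s\<close> times \<open>g\<close>, hence the opposite signs.\<close>

lemma reciprocal_at_ii:
  fixes s :: complex and f g :: "int poly"
  assumes "prime p" "[p = 3] (mod 4)" "3 < p" "s \<noteq> 0"
    and "smult 2 (legendre_prod p 1) = cpoly f + smult s (cpoly g)"
    and "smult 2 (legendre_prod p (-1)) = cpoly f - smult s (cpoly g)"
  shows "\<i> ^ ((p - 1) div 2) * poly (cpoly f) (- \<i>) = - poly (cpoly f) \<i>"
    and "\<i> ^ ((p - 1) div 2) * poly (cpoly g) (- \<i>) = poly (cpoly g) \<i>"
proof -
  define c where "c = \<i> ^ ((p - 1) div 2)"
  define R N where "R = poly (legendre_prod p 1)" and "N = poly (legendre_prod p (-1))"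
  have RN: "2 * R x = poly (cpoly f) x + s * poly (cpoly g) x"
    "2 * N x = poly (cpoly f) x - s * poly (cpoly g) x" for x
    using arg_cong[OF assms(5), of "\<lambda>q. poly q x"] arg_cong[OF assms(6), of "\<lambda>q. poly q x"]
    by (simp_all add: R_def N_def)
  have "2 * poly (cpoly f) x = 2 * (R x + N x)" "2 * (s * poly (cpoly g) x) = 2 * (R x - N x)" for x
    unfolding ring_distribs right_diff_distrib RN by simp_all
  then have f: "poly (cpoly f) x = R x + N x" and g: "s * poly (cpoly g) x = R x - N x" for x
    unfolding mult_cancel_left by simp_all
  have rec: "c * R (- \<i>) = - N \<i>" "c * N (- \<i>) = - R \<i>"
    using legendre_prod_reciprocal[OF assms(1-3), of 1 \<i> "- \<i>"]
      legendre_prod_reciprocal[OF assms(1-3), of "-1" \<i> "- \<i>"]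
    by (simp_all add: R_def N_def c_def)
  show "\<i> ^ ((p - 1) div 2) * poly (cpoly f) (- \<i>) = - poly (cpoly f) \<i>"
    unfolding c_def[symmetric] f ring_distribs rec by simp
  have "s * (c * poly (cpoly g) (- \<i>)) = c * (s * poly (cpoly g) (- \<i>))" by simp
  also have "\<dots> = s * poly (cpoly g) \<i>"
    unfolding g right_diff_distrib rec by simp
  finally show "\<i> ^ ((p - 1) div 2) * poly (cpoly g) (- \<i>) = poly (cpoly g) \<i>"
    using assms(4) by (simp add: c_def)
qed

text \<open>The exponent is 1 or 3 modulo 4 according as \<open>p\<close> is 3 or 7 modulo 8. The
  value is \<open>- istar p\<close>, which explains the sign choice in \<open>istar\<close>.\<close>

lemma ii_power_half:
  assumes "[p = 3] (mod 4)"
  shows "\<i> ^ ((p - 1) div 2) = (if [p = 3] (mod 8) then \<i> else - \<i>)"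
proof -
  let ?m = "(p - 1) div 2"
  have p: "p mod 4 = 3" using assms by (simp add: cong_def)
  have "\<i> ^ ?m = (\<i> ^ 4) ^ (?m div 4) * \<i> ^ (?m mod 4)"
    by (metis mult_div_mod_eq power_add power_mult)
  then have im: "\<i> ^ ?m = \<i> ^ (?m mod 4)" by simp
  show ?thesis
  proof (cases "p mod 8 = 3")
    case True
    then have "p = 8 * (p div 8) + 3" using mult_div_mod_eq[of 8 p] by simp
    then have "?m = 1 + 4 * (p div 8)" by linarith
    then have "?m mod 4 = 1" by (simp only: mod_mult_self2) simp
    then show ?thesis using True im by (simp add: cong_def)
  next
    case False
    then have "p mod 8 = 7" using p mod_double_nat[of p 4] by auto
    then have "p = 8 * (p div 8) + 7" using mult_div_mod_eq[of 8 p] by simp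
    then have "?m = 3 + 4 * (p div 8)" by linarith
    then have "?m mod 4 = 3" by (simp only: mod_mult_self2) simp
    then show ?thesis using False im by (simp add: cong_def power3_eq_cube)
  qed
qed

text \<open>With \<open>j = istar p\<close>, reciprocity says that \<open>f(\<i>)\<close> is
  \<open>j\<close> times its conjugate and \<open>g(\<i>)\<close> is \<open>- j\<close> times its
  conjugate. The Gaussian integers with these properties are the integer multiples of
  \<open>1 + j\<close> and \<open>1 - j\<close>.\<close>

lemma values_at_ii:
  fixes s :: complex and f g :: "int poly"
  assumes "prime p" "[p = 3] (mod 4)" "3 < p" "s \<noteq> 0"
    and "smult 2 (legendre_prod p 1) = cpoly f + smult s (cpoly g)"
    and "smult 2 (legendre_prod p (-1)) = cpoly f - smult s (cpoly g)"
  obtains u w :: int where "poly (cpoly f) \<i> = of_int u * (1 + istar p)"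
    "poly (cpoly g) \<i> = of_int w * (1 - istar p)"
proof -
  have im: "\<i> ^ ((p - 1) div 2) = - istar p"
    using ii_power_half[OF assms(2)] by (simp add: istar_def)
  obtain u v where f: "poly (cpoly f) \<i> = of_int u + \<i> * of_int v"
    "poly (cpoly f) (- \<i>) = of_int u - \<i> * of_int v" using cpoly_at_ii by blast
  obtain w z where g: "poly (cpoly g) \<i> = of_int w + \<i> * of_int z"
    "poly (cpoly g) (- \<i>) = of_int w - \<i> * of_int z" using cpoly_at_ii by blast
  note rec = reciprocal_at_ii[OF assms, unfolded im f g]
  have istar: "istar p = \<i> \<or> istar p = - \<i>" by (simp add: istar_def)
  show ?thesis
  proof
    show "poly (cpoly f) \<i> = of_int u * (1 + istar p)"
      using istar arg_cong[OF rec(1), of Re] unfolding f by (auto simp: complex_eq_iff)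
    show "poly (cpoly g) \<i> = of_int w * (1 - istar p)"
      using istar arg_cong[OF rec(2), of Re] unfolding g by (auto simp: complex_eq_iff)
  qed
qed

lemma istar_square: "istar p ^ 2 = -1"
  by (simp add: istar_def)

text \<open>Integrality exempts \<open>p = 3\<close>: there \<open>f = 2 * x + 1\<close> and
  \<open>g\<close> is 1 or -1, so \<open>b\<close> is \<open>1/2 + \<i>\<close> up to sign.\<close>

theorem mainTheorem3:
  fixes p :: nat and s a b :: complex and f g :: "int poly"
  assumes "prime p" and "odd p"
    and sqrt_pstar: "s ^ 2 = of_int (pstar p)"
    and residues: "smult 2 (legendre_prod p 1) = cpoly f + smult s (cpoly g)"
    and nonresidues: "smult 2 (legendre_prod p (-1)) = cpoly f - smult s (cpoly g)"
    and case1: "[p = 1] (mod 8) \<Longrightarrow>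
      (a, b) =
        (1/4 * (poly (cpoly g) 1 ^ 2 + poly (cpoly f) 1 ^ 2 / of_nat p),
         poly (cpoly f) 1 * poly (cpoly g) 1 / (2 * of_nat p))"
    and case2: "[p = 5] (mod 8) \<Longrightarrow>
      (a, b) =
        (1/64 * ((poly (cpoly g) 1 ^ 3
                   + 3 * poly (cpoly f) 1 ^ 2 * poly (cpoly g) 1 / of_nat p) ^ 2
                 + of_nat p * (poly (cpoly f) 1 ^ 3 / of_nat p ^ 2
                   + 3 * poly (cpoly g) 1 ^ 2 * poly (cpoly f) 1 / of_nat p) ^ 2),
         1/32 * (poly (cpoly g) 1 ^ 3
                   + 3 * poly (cpoly f) 1 ^ 2 * poly (cpoly g) 1 / of_nat p)
              * (poly (cpoly f) 1 ^ 3 / of_nat p ^ 2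
                   + 3 * poly (cpoly g) 1 ^ 2 * poly (cpoly f) 1 / of_nat p))"
    and case3: "[p = 3] (mod 4) \<Longrightarrow>
      (a, b) =
        (istar p / 4 * (of_nat p * poly (cpoly g) \<i> ^ 2 - poly (cpoly f) \<i> ^ 2),
         1/2 * poly (cpoly g) \<i> * poly (cpoly f) \<i>)"
  shows "(p \<noteq> 3 \<longrightarrow> a \<in> \<int> \<and> b \<in> \<int>) \<and> a ^ 2 - of_nat p * b ^ 2 = 1"
proof -
  have "p \<noteq> 0" "p \<noteq> 2" using assms(1,2) by auto
  define f1 g1 where "f1 = poly f 1" and "g1 = poly g 1"
  have vals: "poly (cpoly f) 1 = of_int f1" "poly (cpoly g) 1 = of_int g1"
    by (simp_all add: cpoly_at_1 f1_def g1_def)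
  have mod4: "s ^ 2 = of_nat p" if "p mod 4 = 1"
  proof -
    have "even ((p - 1) div 2)" using that by presburger
    then show ?thesis using sqrt_pstar by (simp add: pstar_def)
  qed
  consider "p mod 8 = 1" | "p mod 8 = 5" | "p mod 4 = 3"
  proof -
    have "p mod 8 = 1 \<or> p mod 8 = 5 \<or> p mod 4 = 3" using \<open>odd p\<close> by presburger
    then show thesis using that by blast
  qed
  then show ?thesis
  proof cases
    case 1
    then have "p mod 4 = 1" using mod_mod_cancel[of 4 8 p] by simp
    then obtain F where F: "f1 = int p * F" "int p * F ^ 2 = g1 ^ 2 + 4"
      using norm_form_at_1[OF assms(1) mod4 residues nonresidues] unfolding f1_def g1_def by blast
    have "int p mod 8 = 1" using 1 zmod_int[of p 8] by simp
    then obtain x y where xy: "g1 ^ 2 + int p * F ^ 2 = 4 * x" "F * g1 = 2 * y"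
      "x ^ 2 - int p * y ^ 2 = 1" using pell_case1[OF F(2)] by blast
    have xy': "of_int g1 ^ 2 + of_nat p * of_int F ^ 2 = 4 * (of_int x :: complex)"
      "of_int F * of_int g1 = 2 * (of_int y :: complex)"
      using arg_cong[OF xy(1), of complex_of_int] arg_cong[OF xy(2), of complex_of_int] by simp_all
    have "[p = 1] (mod 8)" using 1 by (simp add: cong_def)
    from case1[OF this] have
      "a = 1/4 * (of_int g1 ^ 2 + of_nat p * of_int F ^ 2)" "b = of_int F * of_int g1 / 2"
      using \<open>p \<noteq> 0\<close> by (simp_all add: vals F(1) power2_eq_square)
    then have ab: "a = of_int x" "b = of_int y" unfolding xy' by simp_all
    have "a ^ 2 - of_nat p * b ^ 2 = of_int (x ^ 2 - int p * y ^ 2)" by (simp add: ab)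
    then show ?thesis unfolding xy(3) by (simp add: ab)
  next
    case 2
    then have "p mod 4 = 1" using mod_mod_cancel[of 4 8 p] by simp
    then obtain F where F: "f1 = int p * F" "int p * F ^ 2 = g1 ^ 2 + 4"
      using norm_form_at_1[OF assms(1) mod4 residues nonresidues] unfolding f1_def g1_def by blast
    obtain A B where AB: "g1 ^ 3 + 3 * int p * F ^ 2 * g1 = 8 * A"
      "int p * F ^ 3 + 3 * g1 ^ 2 * F = 8 * B" "A ^ 2 - int p * B ^ 2 = -1"
      using pell_case2[OF F(2)] \<open>odd p\<close> by auto
    have "of_int g1 ^ 3 + 3 * of_int f1 ^ 2 * of_int g1 / of_nat p
        = complex_of_int (g1 ^ 3 + 3 * int p * F ^ 2 * g1)"
      using \<open>p \<noteq> 0\<close> by (simp add: F(1) power2_eq_square)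
    then have A: "of_int g1 ^ 3 + 3 * of_int f1 ^ 2 * of_int g1 / of_nat p = 8 * complex_of_int A"
      unfolding AB by simp
    have "of_int f1 ^ 3 / of_nat p ^ 2 + 3 * of_int g1 ^ 2 * of_int f1 / of_nat p
        = complex_of_int (int p * F ^ 3 + 3 * g1 ^ 2 * F)"
      using \<open>p \<noteq> 0\<close> by (simp add: F(1) power2_eq_square power3_eq_cube)
    then have B: "of_int f1 ^ 3 / of_nat p ^ 2 + 3 * of_int g1 ^ 2 * of_int f1 / of_nat p
        = 8 * complex_of_int B"
      unfolding AB by simp
    have "[p = 5] (mod 8)" using 2 by (simp add: cong_def)
    from case2[OF this] have ab: "a = of_int (A ^ 2 + int p * B ^ 2)" "b = of_int (2 * A * B)"
      unfolding vals A B by (simp_all add: power_mult_distrib algebra_simps)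
    \<comment> \<open>The pair is the square of A + B sqrt p, so its norm is the square of
      -1.\<close>
    have "(A ^ 2 + int p * B ^ 2) ^ 2 - int p * (2 * A * B) ^ 2 = (A ^ 2 - int p * B ^ 2) ^ 2"
      by (simp add: power2_eq_square algebra_simps)
    then have pell: "(A ^ 2 + int p * B ^ 2) ^ 2 - int p * (2 * A * B) ^ 2 = 1"
      unfolding AB by simp
    have "a ^ 2 - of_nat p * b ^ 2
        = of_int ((A ^ 2 + int p * B ^ 2) ^ 2 - int p * (2 * A * B) ^ 2)" by (simp add: ab)
    then show ?thesis unfolding pell by (simp add: ab)
  next
    case 3
    then have cong3: "[p = 3] (mod 4)" by (simp add: cong_def)
    have "odd ((p - 1) div 2)" using 3 by presburger
    then have s2: "s ^ 2 = - of_nat p" using sqrt_pstar by (simp add: pstar_def)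
    then have "s \<noteq> 0" using \<open>p \<noteq> 0\<close> by auto
    define fi gi j where "fi = poly (cpoly f) \<i>" and "gi = poly (cpoly g) \<i>" and "j = istar p"
    have j2: "j ^ 2 = -1" by (simp add: j_def istar_square)
    have ab: "a = j / 4 * (of_nat p * gi ^ 2 - fi ^ 2)" "b = 1/2 * gi * fi"
      using case3[OF cong3] by (simp_all add: fi_def gi_def j_def)
    have norm: "fi ^ 2 + of_nat p * gi ^ 2 = 4 * \<i>"
      using norm_form_at_ii[OF assms(1) cong3 s2 residues nonresidues] by (simp add: fi_def gi_def)
    have "16 * a ^ 2 = j ^ 2 * (of_nat p * gi ^ 2 - fi ^ 2) ^ 2"
      unfolding ab by (simp only: power_mult_distrib power_divide) simp
    moreover have "16 * b ^ 2 = 4 * gi ^ 2 * fi ^ 2"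
      unfolding ab by (simp add: power_mult_distrib power_divide)
    ultimately have "16 * (a ^ 2 - of_nat p * b ^ 2)
        = j ^ 2 * (of_nat p * gi ^ 2 - fi ^ 2) ^ 2 - 4 * of_nat p * gi ^ 2 * fi ^ 2"
      by (simp only: right_diff_distrib) (simp add: algebra_simps)
    \<comment> \<open>As \<open>j ^ 2 = -1\<close>, the terms combine to minus the square of the
      norm form, which is \<open>4 * \<i>\<close>.\<close>
    also have "\<dots> = - ((fi ^ 2 + of_nat p * gi ^ 2) ^ 2)"
      unfolding j2 by (simp add: power2_eq_square algebra_simps)
    also have "\<dots> = 16" unfolding norm by (simp add: power_mult_distrib)
    finally have "16 * (a ^ 2 - of_nat p * b ^ 2) = 16 * 1" by (simp only: mult_1_right)
    then have pell: "a ^ 2 - of_nat p * b ^ 2 = 1" by (simp only: mult_cancel_left) simp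
    have "a \<in> \<int> \<and> b \<in> \<int>" if "p \<noteq> 3"
    proof -
      have "3 < p" using 3 that mod_less_eq_dividend[of p 4] by simp
      obtain u w where uw: "fi = of_int u * (1 + j)" "gi = of_int w * (1 - j)"
        using values_at_ii[OF assms(1) cong3 \<open>3 < p\<close> \<open>s \<noteq> 0\<close> residues nonresidues]
        unfolding fi_def gi_def j_def by blast
      have j: "(1 + j) ^ 2 = 2 * j" "(1 - j) ^ 2 = - 2 * j" "(1 - j) * (1 + j) = 2" "j * j = -1"
        using j2 by (simp_all add: power2_eq_square algebra_simps)
      have sq: "fi ^ 2 = 2 * j * of_int u ^ 2" "gi ^ 2 = - 2 * j * of_int w ^ 2"
        by (simp_all add: uw power_mult_distrib j)
      have "b = of_int u * of_int w * ((1 - j) * (1 + j)) / 2" by (simp add: ab uw)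
      then have b: "b = of_int (u * w)" by (simp add: j(3))
      have "a = - (j * j) * (of_nat p * of_int w ^ 2 + of_int u ^ 2) / 2"
        by (simp add: ab sq algebra_simps)
      then have a: "a = of_int (int p * w ^ 2 + u ^ 2) / 2" by (simp add: j(4))
      \<comment> \<open>The norm equation becomes \<open>2 * j * d = 4 * \<i>\<close>, so
        \<open>d\<close> is 2 or -2. The numerator of \<open>a\<close> has the parity of
        \<open>d\<close>, hence is even.\<close>
      define d where "d = u ^ 2 - int p * w ^ 2"
      have "2 * j * of_int d = 4 * \<i>"
        using norm unfolding sq by (simp add: d_def algebra_simps)
      then have "d = 2 \<or> d = -2"
        by (auto simp: j_def istar_def complex_eq_iff split: if_splits)
      moreover have "int p * w ^ 2 + u ^ 2 = 2 * (int p * w ^ 2) + d" by (simp add: d_def)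
      ultimately have "even (int p * w ^ 2 + u ^ 2)" by auto
      then obtain c where "int p * w ^ 2 + u ^ 2 = 2 * c" by blast
      then have "a = of_int c" using a by simp
      then show ?thesis using b by simp
    qed
    then show ?thesis using pell by simp
  qed
qed

end
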